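(* Let $\{x^k\}_{k\ge1}$ be generated by the block prox-linear (BPL) method described in the context (under Assumptions 1, 2 and 3 stated there), with $\alpha_k=\frac{1}{2L_k}$ for all $k$ and $\tilde\omega_i^j\le\frac{\delta}{6}\sqrt{\tilde L_i^{j-1}/\tilde L_i^{j}}$ for all $i,j$, for some $0\le\delta<1$. Then any limit point $\bar x$ of $\{x^k\}_{k\ge1}$ is a critical point of $F$, i.e. $0\in\partial F(\bar x)$. Moreover, if the subsequence $\{x^k\}_{k\in\bar{\mathcal K}}$ (with $\bar{\mathcal K}\subseteq\mathbb{N}$ infinite) converges to $\bar x$, then $$\lim_{\bar{\mathcal K}\ni k\to\infty}F(x^k)=F(\bar x).$$
   Context: Problem: minimize $F(x)=f(x_1,\dots,x_s)+\sum_{i=1}^s r_i(x_i)$ over $x=(x_1,\dots,x_s)\in\mathbb{R}^n$ ($s\ge1$ blocks), with Euclidean norm $\|\cdot\|$. No convexity is assumed. Assumption 1: $f$ is (real-valued and) continuously differentiable; each $r_i$ is proper lower semicontinuous with values in $(-\infty,+\infty]$; $F$ is proper and bounded below on $\mathrm{dom}(F)=\{x:F(x)<+\infty\}$; there is $x^*$ with $0\in\partial F(x^* )$. Subdifferential: $g$ is a Fréchet subgradient of a lower semicontinuous $F$ at $x\in\mathrm{dom}(F)$, written $g\in\hat\partial F(x)$, if $\liminf_{y\to x,\,y\ne x}\frac{F(y)-F(x)-\langle g,y-x\rangle}{\|y-x\|}\ge0$; $\hat\partial F(x)=\emptyset$ for $x\notin\mathrm{dom}(F)$. The limiting subdifferential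 is $\partial F(x)=\{g:\exists\,x_m\to x,\ g_m\in\hat\partial F(x_m),\ g_m\to g\}$. For this $F$ it holds that $\partial F(x)=\prod_{i=1}^s\{\nabla_{x_i}f(x)+\partial r_i(x_i)\}$. BPL method: start from $x^{-1}=x^0$. At iteration $k=1,2,\dots$ a block $b_k\in\{1,\dots,s\}$ is picked; for $i\ne b_k$ set $x_i^k=x_i^{k-1}$; for $i=b_k$ choose $$x_i^k\in\arg\min_{x_i}\ \langle\nabla_{x_i}f(x_{\ne i}^{k-1},\hat x_i^k),x_i-\hat x_i^k\rangle+\frac1{2\alpha_k}\|x_i-\hat x_i^k\|^2+r_i(x_i),\qquad \hat x_i^k=x_i^{k-1}+\omega_k(x_i^{k-1}-x_i^{\mathrm{prev}}),$$ where $(x_{\neq i}^{k-1},u)$ denotes $x^{k-1}$ with its $i$-th block replaced by $u$, $\alpha_k>0$ is a stepsize, $0\le\omega_k\le1$ is an extrapolation weight and $x_i^{\mathrm{prev}}$ is the value of block $i$ before it was updated to $x_i^{k-1}$. Assumption 2: for $i=b_k$, $u\mapsto\nabla_{x_i}f(x_{\ne i}^{k-1},u)$ is Lipschitz with constant $L_k$, and $0<\ell\le L_k\le L<\infty$ for all $k$. Assumption 3: within any $T$ consecutive iterations every block is updated at least once. Notation: $d_i^k$ is the number of updates of block $i$ during iterations $1,\dots,k$; $\tilde x_i^j$ is the value of block $i$ after its $j$-th update (so $x_i^k=\tilde x_i^{d_i^k}$), with $\tilde x_i^{-1}=\tilde x_i^0=x_i^0$; $\tilde L_i^j$ and $\tilde\omega_i^j$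 are the values of $L_k$ and $\omega_k$ at the iteration $k$ of the $j$-th update of block $i$. Thus $\hat x_i^k=\tilde x_i^{j-1}+\omega_k(\tilde x_i^{j-1}-\tilde x_i^{j-2})$ with $i=b_k$, $j=d_i^k$. The value $\tilde L_i^0>0$ is an arbitrary fixed number. *)

theory Defs
  imports "HOL-Analysis.Analysis"
begin

section \<open>Extended-valued functions and subdifferentials\<close>

definition proper_on :: "'a set \<Rightarrow> ('a \<Rightarrow> ereal) \<Rightarrow> bool" where
  "proper_on S g \<longleftrightarrow> (\<forall>u\<in>S. g u \<noteq> -\<infinity>) \<and> (\<exists>u\<in>S. g u < \<infinity>)"

definition lsc_on :: "'a::topological_space set \<Rightarrow> ('a \<Rightarrow> ereal) \<Rightarrow> bool" where
  "lsc_on S g \<longleftrightarrow> (\<forall>u\<in>S. g u \<le> Liminf (at u within S) g)"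

definition frechet_subdiff :: "('a::real_inner \<Rightarrow> ereal) \<Rightarrow> 'a \<Rightarrow> 'a set" where
  "frechet_subdiff F x =
     {g. F x < \<infinity> \<and>
         0 \<le> Liminf (at x) (\<lambda>y. (F y - F x - ereal (g \<bullet> (y - x))) / ereal (norm (y - x)))}"

text \<open>The limits are taken without the additional requirement \<open>F (xs m) \<longlonglongrightarrow> F x\<close>
  that some authors impose.\<close>

definition limiting_subdiff :: "('a::real_inner \<Rightarrow> ereal) \<Rightarrow> 'a \<Rightarrow> 'a set" where
  "limiting_subdiff F x =
     {g. \<exists>xs gs. xs \<longlonglongrightarrow> x \<and> (\<forall>m. gs m \<in> frechet_subdiff F (xs m)) \<and> gs \<longlonglongrightarrow> g}"

section \<open>Block structure\<close>

text \<open>The coordinates of \<open>real ^ 'n\<close> are partitioned into blocks indexed by \<open>'s\<close>: coordinate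
  \<open>j\<close> belongs to block \<open>blk j\<close>. So that blocks may have different dimensions within one type,
  the space of the \<open>i\<close>-th block is represented by the subspace of the vectors vanishing
  off block \<open>i\<close> (with the inherited Euclidean norm), and \<open>x\<^sub>i\<close> by the projection of \<open>x\<close> to it.
  A function of the block variable \<open>x\<^sub>i\<close> only matters on that subspace.\<close>

definition block_space :: "('n::finite \<Rightarrow> 's) \<Rightarrow> 's \<Rightarrow> (real ^ 'n) set" where
  "block_space blk i = {u. \<forall>j. blk j \<noteq> i \<longrightarrow> u $ j = 0}"

definition block :: "('n::finite \<Rightarrow> 's) \<Rightarrow> 's \<Rightarrow> real ^ 'n \<Rightarrow> real ^ 'n" where
  "block blk i x = (\<chi> j. if blk j = i then x $ j else 0)"

definition replace_block :: "('n::finite \<Rightarrow> 's) \<Rightarrow> 's \<Rightarrow> real ^ 'n \<Rightarrow> real ^ 'n \<Rightarrow> real ^ 'n" where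
  "replace_block blk i x u = (\<chi> j. if blk j = i then u $ j else x $ j)"

section \<open>The block prox-linear method\<close>

text \<open>Iterations are numbered from \<open>1\<close>; values of \<open>b\<close>, \<open>\<alpha>\<close>, \<open>\<omega>\<close>, \<open>Lc\<close> at \<open>0\<close> are never used,
  and \<open>x 0\<close> is the starting point.\<close>

definition num_updates :: "(nat \<Rightarrow> 's) \<Rightarrow> 's \<Rightarrow> nat \<Rightarrow> nat" where
  "num_updates b i k = card {m \<in> {1..k}. b m = i}"

text \<open>For \<open>j \<ge> 1\<close> this is the iteration of the \<open>j\<close>-th update of block \<open>i\<close>
  (if there are at least \<open>j\<close> updates), and for \<open>j = 0\<close> it is \<open>0\<close>.\<close>

definition update_iter :: "(nat \<Rightarrow> 's) \<Rightarrow> 's \<Rightarrow> nat \<Rightarrow> nat" where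
  "update_iter b i j = (LEAST k. num_updates b i k = j)"

definition block_value ::
  "('n::finite \<Rightarrow> 's) \<Rightarrow> (nat \<Rightarrow> 's) \<Rightarrow> (nat \<Rightarrow> real ^ 'n) \<Rightarrow> 's \<Rightarrow> nat \<Rightarrow> real ^ 'n" where
  "block_value blk b x i j = block blk i (x (update_iter b i j))"

definition lip_value :: "(nat \<Rightarrow> 's) \<Rightarrow> ('s \<Rightarrow> real) \<Rightarrow> (nat \<Rightarrow> real) \<Rightarrow> 's \<Rightarrow> nat \<Rightarrow> real" where
  "lip_value b L0 Lc i j = (if j = 0 then L0 i else Lc (update_iter b i j))"

text \<open>The extrapolated point of iteration \<open>k\<close>. For \<open>j = 1\<close> the truncated subtraction
  \<open>j - 2 = 0\<close> realises the convention that the values with indices \<open>-1\<close> and \<open>0\<close> agree.\<close>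

definition extrapolated ::
  "('n::finite \<Rightarrow> 's) \<Rightarrow> (nat \<Rightarrow> 's) \<Rightarrow> (nat \<Rightarrow> real) \<Rightarrow> (nat \<Rightarrow> real ^ 'n) \<Rightarrow> nat \<Rightarrow> real ^ 'n" where
  "extrapolated blk b \<omega> x k =
     (let i = b k; j = num_updates b i k
      in block_value blk b x i (j - 1)
         + \<omega> k *\<^sub>R (block_value blk b x i (j - 1) - block_value blk b x i (j - 2)))"

definition bpl_subproblem ::
  "('n::finite \<Rightarrow> 's) \<Rightarrow> (real ^ 'n \<Rightarrow> real ^ 'n) \<Rightarrow> ('s \<Rightarrow> real ^ 'n \<Rightarrow> ereal) \<Rightarrow> real
   \<Rightarrow> 's \<Rightarrow> real ^ 'n \<Rightarrow> real ^ 'n \<Rightarrow> real ^ 'n \<Rightarrow> ereal" where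
  "bpl_subproblem blk gradf r a i y xhat u =
     ereal (block blk i (gradf (replace_block blk i y xhat)) \<bullet> (u - xhat)
            + 1 / (2 * a) * (norm (u - xhat))\<^sup>2)
     + r i u"

definition bpl_sequence ::
  "('n::finite \<Rightarrow> 's) \<Rightarrow> (real ^ 'n \<Rightarrow> real ^ 'n) \<Rightarrow> ('s \<Rightarrow> real ^ 'n \<Rightarrow> ereal)
   \<Rightarrow> (nat \<Rightarrow> 's) \<Rightarrow> (nat \<Rightarrow> real) \<Rightarrow> (nat \<Rightarrow> real) \<Rightarrow> (nat \<Rightarrow> real ^ 'n) \<Rightarrow> bool" where
  "bpl_sequence blk gradf r b \<alpha> \<omega> x \<longleftrightarrow>
     (\<forall>k\<ge>1. \<alpha> k > 0 \<and> 0 \<le> \<omega> k \<and> \<omega> k \<le> 1 \<and>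
        (\<forall>i. i \<noteq> b k \<longrightarrow> block blk i (x k) = block blk i (x (k - 1))) \<and>
        is_arg_min
          (bpl_subproblem blk gradf r (\<alpha> k) (b k) (x (k - 1)) (extrapolated blk b \<omega> x k))
          (\<lambda>u. u \<in> block_space blk (b k))
          (block blk (b k) (x k)))"

end

theory Submission
  imports Defs
begin

text \<open>With the stepsize \<open>1 / (2 L\<^sub>k)\<close>, comparing the new block value with the old one in the
  subproblem gives
  \<open>F (x\<^sub>k) \<le> F (x\<^sub>k\<^sub>-\<^sub>1) - L\<^sub>k/2 \<parallel>s\<^sub>k\<parallel>\<^sup>2 + 3 L\<^sub>k \<omega>\<^sub>k \<parallel>s\<^sub>p\<parallel> \<parallel>s\<^sub>k\<parallel>\<close>, where \<open>s\<^sub>k\<close> is the step and \<open>s\<^sub>p\<close> the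
  previous step of the same block. The bound on \<open>\<omega>\<^sub>k\<close> turns the last term into
  \<open>\<delta>/4 (L\<^sub>k \<parallel>s\<^sub>k\<parallel>\<^sup>2 + L\<^sub>p \<parallel>s\<^sub>p\<parallel>\<^sup>2)\<close>, so that \<open>F\<close> plus \<open>\<delta>/4\<close> times the weighted squared
  latest steps of all blocks decreases by at least \<open>(1 - \<delta>)/2 l \<parallel>s\<^sub>k\<parallel>\<^sup>2\<close>; hence \<open>s\<^sub>k \<rightarrow> 0\<close>.
  As every block was updated at most \<open>T\<close> iterations ago, the optimality conditions of the
  latest updates assemble to a Frechet subgradient of \<open>F\<close> at \<open>x\<^sub>k\<close> which tends to \<open>0\<close> along a
  convergent subsequence. Comparing the new block value with the block of the limit in the
  subproblem bounds the limit superior of \<open>r\<^sub>i\<close> along the subsequence by its value at the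
  limit, and lower semicontinuity gives the converse. The starting point may lie outside
  the domain of \<open>F\<close>, so all of this is done from iteration \<open>T\<close> on.\<close>

section \<open>Extended-valued functions\<close>

text \<open>Uses \<open>nhds u\<close> in place of the punctured filter of \<open>lsc_on\<close>,
  because the sequence it is applied to may hit \<open>u\<close>.\<close>

lemma lsc_onD_eventually:
  assumes "lsc_on S g" "u \<in> S" "c < g u"
  shows "eventually (\<lambda>v. v \<in> S \<longrightarrow> c < g v) (nhds u)"
proof -
  have "eventually (\<lambda>v. c < g v) (at u within S)"
    using assms by (auto simp: lsc_on_def le_Liminf_iff)
  then show ?thesis
    unfolding eventually_at_filter
    by (rule eventually_mono) (use assms in auto)
qed

lemma tendsto_sum_ereal:
  fixes h :: "'i \<Rightarrow> 'a \<Rightarrow> ereal"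
  assumes "\<And>i. i \<in> I \<Longrightarrow> (h i \<longlongrightarrow> c i) net" "\<And>i. i \<in> I \<Longrightarrow> c i \<noteq> -\<infinity>"
  shows "((\<lambda>m. \<Sum>i\<in>I. h i m) \<longlongrightarrow> (\<Sum>i\<in>I. c i)) net"
proof (cases "finite I")
  case True
  \<comment> \<open>Addition on \<open>ereal\<close> is discontinuous only at opposite infinities,
    so the induction also carries that the sum of the limits is not minus infinity.\<close>
  then have "((\<lambda>m. \<Sum>i\<in>I. h i m) \<longlongrightarrow> (\<Sum>i\<in>I. c i)) net \<and> (\<Sum>i\<in>I. c i) \<noteq> -\<infinity>"
    using assms
    by (induction I rule: finite_induct) (auto intro!: tendsto_add_ereal_general)
  then show ?thesis ..
qed simp

text \<open>The quadratic term of the minorant costs the difference quotient only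
  \<open>c * norm (y - x)\<close>, and the remainder of \<open>f\<close> vanishes by
  differentiability; \<open>q\<close> collects both.\<close>

lemma frechet_subdiff_sum:
  fixes f :: "'a::real_inner \<Rightarrow> real" and H :: "'a \<Rightarrow> ereal"
  assumes f: "GDERIV f x :> d"
    and Hx: "H x = ereal h"
    and H: "\<And>y. ereal (h + g \<bullet> (y - x) - c * (norm (y - x))\<^sup>2) \<le> H y"
  shows "d + g \<in> frechet_subdiff (\<lambda>y. ereal (f y) + H y) x"
proof -
  define q where "q y = (f y - f x - (y - x) \<bullet> d) / norm (y - x) - c * norm (y - x)" for y
  have "((\<lambda>y. norm (f y - f x - (y - x) \<bullet> d) / norm (y - x)) \<longlongrightarrow> 0) (at x)"
    using f unfolding gderiv_def has_derivative_iff_norm by blast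
  then have "((\<lambda>y. norm ((f y - f x - (y - x) \<bullet> d) / norm (y - x))) \<longlongrightarrow> 0) (at x)"
    by simp
  then have "((\<lambda>y. (f y - f x - (y - x) \<bullet> d) / norm (y - x)) \<longlongrightarrow> 0) (at x)"
    by (rule tendsto_norm_zero_cancel)
  then have "(q \<longlongrightarrow> 0 - c * norm (x - x)) (at x)"
    unfolding q_def by (intro tendsto_intros)
  then have q0: "(q \<longlongrightarrow> 0) (at x)"
    by simp
  have le: "ereal (q y) \<le> (ereal (f y) + H y - (ereal (f x) + H x) - ereal ((d + g) \<bullet> (y - x)))
      / ereal (norm (y - x))" if "y \<noteq> x" for y
  proof (cases "H y")
    case (real w)
    then have w: "h + g \<bullet> (y - x) - c * (norm (y - x))\<^sup>2 \<le> w"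
      using H[of y] by simp
    have pos: "0 < norm (y - x)"
      using that by simp
    have "q y * norm (y - x) = f y - f x - (y - x) \<bullet> d - c * (norm (y - x))\<^sup>2"
      using pos by (simp add: q_def left_diff_distrib[of "_ / _"] power2_eq_square)
    also have "\<dots> \<le> f y + w - (f x + h) - (d + g) \<bullet> (y - x)"
      using w by (simp add: inner_add_left inner_commute[of "y - x"])
    finally have "q y \<le> (f y + w - (f x + h) - (d + g) \<bullet> (y - x)) / norm (y - x)"
      using pos by (simp add: pos_le_divide_eq)
    then show ?thesis
      using real Hx pos by simp
  next
    case PInf
    then show ?thesis
      using Hx that by (simp add: divide_ereal_def)
  next
    case MInf
    then show ?thesis
      using H[of y] by simp
  qed
  have "0 \<le> Liminf (at x) (\<lambda>y. (ereal (f y) + H y - (ereal (f x) + H x)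
      - ereal ((d + g) \<bullet> (y - x))) / ereal (norm (y - x)))"
    unfolding le_Liminf_iff
  proof (intro allI impI)
    fix e :: ereal
    assume "e < 0"
    moreover have "((\<lambda>y. ereal (q y)) \<longlongrightarrow> 0) (at x)"
      using tendsto_ereal[OF q0] by (simp add: zero_ereal_def)
    ultimately have "eventually (\<lambda>y. e < ereal (q y)) (at x)"
      by (rule order_tendstoD(1)[rotated])
    moreover have "eventually (\<lambda>y. y \<noteq> x) (at x)"
      by (simp add: eventually_at_filter)
    ultimately show "eventually (\<lambda>y. e < (ereal (f y) + H y - (ereal (f x) + H x)
        - ereal ((d + g) \<bullet> (y - x))) / ereal (norm (y - x))) (at x)"
      by eventually_elim (use le less_le_trans in blast)
  qed
  then show ?thesis
    using Hx by (simp add: frechet_subdiff_def)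
qed

section \<open>Descent along a segment\<close>

text \<open>\<open>M\<close> concerns only the direction \<open>s\<close>, because Assumption 2
  controls one block of the gradient at a time. The function \<open>h\<close> is \<open>f\<close>
  along the segment minus the varying part of its quadratic majorant, and \<open>M\<close> makes it
  nonincreasing.\<close>

lemma descent_on_segment:
  fixes f :: "'a::real_inner \<Rightarrow> real"
  assumes f: "\<And>y. GDERIV f y :> gradf y"
    and M: "\<And>t. 0 \<le> t \<Longrightarrow> t \<le> 1 \<Longrightarrow> (gradf (x + t *\<^sub>R s) - gradf x) \<bullet> s \<le> M * t * (norm s)\<^sup>2"
  shows "f (x + s) \<le> f x + gradf x \<bullet> s + M / 2 * (norm s)\<^sup>2"
proof -
  define h where "h t = f (x + t *\<^sub>R s) - t * (gradf x \<bullet> s) - M / 2 * t\<^sup>2 * (norm s)\<^sup>2" for t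
  have "h 1 \<le> h 0"
  proof (rule DERIV_nonpos_imp_nonincreasing[where f = h])
    fix t :: real
    assume t: "0 \<le> t" "t \<le> 1"
    have "((\<lambda>t. x + t *\<^sub>R s) has_derivative (\<lambda>v. v *\<^sub>R s)) (at t)"
      by (auto intro!: derivative_eq_intros)
    moreover have "(f has_derivative (\<lambda>v. v \<bullet> gradf (x + t *\<^sub>R s))) (at (x + t *\<^sub>R s))"
      using f unfolding gderiv_def by blast
    ultimately have "((\<lambda>t. f (x + t *\<^sub>R s)) has_derivative (\<lambda>v. (v *\<^sub>R s) \<bullet> gradf (x + t *\<^sub>R s))) (at t)"
      by (rule has_derivative_compose)
    then have "((\<lambda>t. f (x + t *\<^sub>R s)) has_field_derivative gradf (x + t *\<^sub>R s) \<bullet> s) (at t)"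
      by (simp add: has_field_derivative_def inner_commute mult_commute_abs)
    then have "(h has_field_derivative
        gradf (x + t *\<^sub>R s) \<bullet> s - gradf x \<bullet> s - M * t * (norm s)\<^sup>2) (at t)"
      unfolding h_def by (auto intro!: derivative_eq_intros)
    then show "\<exists>y. DERIV h t :> y \<and> y \<le> 0"
      using M[OF t] by (auto simp: inner_diff_left)
  qed simp
  then show ?thesis
    by (simp add: h_def)
qed

section \<open>Blocks\<close>

lemma block_in_block_space [simp]: "block blk i y \<in> block_space blk i"
  by (simp add: block_def block_space_def)

lemma block_eq_self: "u \<in> block_space blk i \<Longrightarrow> block blk i u = u"
  by (auto simp: block_def block_space_def vec_eq_iff)

lemma block_add: "block blk i (y + z) = block blk i y + block blk i z"
  by (simp add: block_def vec_eq_iff)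

lemma block_scaleR: "block blk i (c *\<^sub>R y) = c *\<^sub>R block blk i y"
  by (simp add: block_def vec_eq_iff)

lemma block_diff: "block blk i (y - z) = block blk i y - block blk i z"
  by (simp add: block_def vec_eq_iff)

lemma sum_block:
  fixes blk :: "'n::finite \<Rightarrow> 's::finite"
  shows "(\<Sum>i\<in>UNIV. block blk i y) = y"
  by (simp add: block_def vec_eq_iff)

lemma replace_block_eq: "replace_block blk i y u = y - block blk i y + block blk i u"
  by (simp add: replace_block_def block_def vec_eq_iff)

lemma block_inner: "u \<in> block_space blk i \<Longrightarrow> block blk i g \<bullet> u = g \<bullet> u"
  by (auto simp: block_def block_space_def inner_vec_def intro!: sum.cong)

text \<open>Only the component of \<open>g\<close> in the block enters, so a Lipschitz bound for
  that component suffices later.\<close>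

lemma inner_le_norm_block:
  assumes "u \<in> block_space blk i"
  shows "g \<bullet> u \<le> norm (block blk i g) * norm u"
  using norm_cauchy_schwarz[of "block blk i g" u] by (simp add: block_inner[OF assms])

lemma block_inner_block: "block blk i g \<bullet> block blk i y = block blk i g \<bullet> y"
  by (auto simp: block_def inner_vec_def intro!: sum.cong)

lemma norm_block_le: "norm (block blk i y) \<le> norm y"
  by (rule norm_le_componentwise_cart) (simp add: block_def)

lemma bounded_linear_block: "bounded_linear (block blk i)"
  by (rule bounded_linear_intro[where K = 1])
    (simp_all add: block_add block_scaleR norm_block_le)

lemmas tendsto_block [tendsto_intros] = bounded_linear.tendsto[OF bounded_linear_block]

section \<open>Update counts\<close>

lemma num_updates_Suc:
  "num_updates b i (Suc k) = num_updates b i k + (if b (Suc k) = i then 1 else 0)"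
proof -
  have "{m \<in> {1..Suc k}. b m = i}
      = (if b (Suc k) = i then insert (Suc k) {m \<in> {1..k}. b m = i} else {m \<in> {1..k}. b m = i})"
    by (auto simp: le_Suc_eq)
  then show ?thesis
    by (simp add: num_updates_def)
qed

lemma num_updates_mono: "k \<le> k' \<Longrightarrow> num_updates b i k \<le> num_updates b i k'"
  by (rule lift_Suc_mono_le[of "num_updates b i"]) (simp_all add: num_updates_Suc)

text \<open>The value is \<open>0\<close> when block \<open>i\<close> has not been updated yet.
  Going through \<open>update_iter\<close> keeps the indexing of \<open>block_value\<close> and
  \<open>lip_value\<close>.\<close>

definition last_update :: "(nat \<Rightarrow> 's) \<Rightarrow> 's \<Rightarrow> nat \<Rightarrow> nat" where
  "last_update b i k = update_iter b i (num_updates b i k)"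

lemma num_updates_last_update: "num_updates b i (last_update b i k) = num_updates b i k"
  unfolding last_update_def update_iter_def by (rule LeastI) (rule refl)

lemma last_update_le: "last_update b i k \<le> k"
  unfolding last_update_def update_iter_def by (rule Least_le) (rule refl)

lemma last_update_minimal:
  assumes "num_updates b i m = num_updates b i k"
  shows "last_update b i k \<le> m"
  unfolding last_update_def update_iter_def by (rule Least_le) (rule assms)

lemma last_update_ge:
  assumes "1 \<le> m" "m \<le> k" "b m = i"
  shows "m \<le> last_update b i k"
proof (rule ccontr)
  assume "\<not> m \<le> last_update b i k"
  then have "num_updates b i (last_update b i k) \<le> num_updates b i (m - 1)"
    by (intro num_updates_mono) simp
  also have "\<dots> < num_updates b i m"
    using num_updates_Suc[of b i "m - 1"] assms by simp
  also have "\<dots> \<le> num_updates b i k"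
    using assms by (intro num_updates_mono)
  finally show False
    by (simp add: num_updates_last_update)
qed

text \<open>Were that iteration an update of another block, its predecessor would have the same
  count, against minimality in \<open>update_iter\<close>.\<close>

lemma block_last_update:
  assumes "1 \<le> last_update b i k"
  shows "b (last_update b i k) = i"
proof (rule ccontr)
  assume "b (last_update b i k) \<noteq> i"
  then have "num_updates b i (last_update b i k - 1) = num_updates b i k"
    using num_updates_Suc[of b i "last_update b i k - 1"] assms num_updates_last_update[of b i k]
    by simp
  then have "last_update b i k \<le> last_update b i k - 1"
    by (rule last_update_minimal)
  with assms show False
    by simp
qed

lemma last_update_self: "1 \<le> k \<Longrightarrow> last_update b (b k) k = k"
  by (intro antisym last_update_le last_update_ge) auto

lemma last_update_unchanged: "1 \<le> k \<Longrightarrow> b k \<noteq> i \<Longrightarrow> last_update b i k = last_update b i (k - 1)"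
  using num_updates_Suc[of b i "k - 1"] by (simp add: last_update_def)

section \<open>The iteration\<close>

locale bpl_method =
  fixes blk :: "'n::finite \<Rightarrow> 's::finite"
    and f :: "real ^ 'n \<Rightarrow> real"
    and gradf :: "real ^ 'n \<Rightarrow> real ^ 'n"
    and r :: "'s \<Rightarrow> real ^ 'n \<Rightarrow> ereal"
    and F :: "real ^ 'n \<Rightarrow> ereal"
    and b :: "nat \<Rightarrow> 's"
    and \<alpha> \<omega> Lc :: "nat \<Rightarrow> real"
    and L0 :: "'s \<Rightarrow> real"
    and l L \<delta> :: real
    and T :: nat
    and x :: "nat \<Rightarrow> real ^ 'n"
  assumes F_eq: "F = (\<lambda>y. ereal (f y) + (\<Sum>i\<in>UNIV. r i (block blk i y)))"
    and f_grad: "\<And>y. GDERIV f y :> gradf y"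
    and f_C1: "continuous_on UNIV gradf"
    and r_proper: "\<And>i. proper_on (block_space blk i) (r i)"
    and r_lsc: "\<And>i. lsc_on (block_space blk i) (r i)"
    and F_bounded_below: "\<exists>m::real. \<forall>y. F y < \<infinity> \<longrightarrow> ereal m \<le> F y"
    and bpl: "bpl_sequence blk gradf r b \<alpha> \<omega> x"
    and lipschitz: "\<And>k. k \<ge> 1 \<Longrightarrow>
          (Lc k)-lipschitz_on (block_space blk (b k))
            (\<lambda>u. block blk (b k) (gradf (replace_block blk (b k) (x (k - 1)) u)))"
    and l_pos: "0 < l"
    and Lc_bounds: "\<And>k. k \<ge> 1 \<Longrightarrow> l \<le> Lc k \<and> Lc k \<le> L"
    and essentially_cyclic: "\<And>i k. \<exists>m\<in>{k + 1..k + T}. b m = i"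
    and stepsize: "\<And>k. k \<ge> 1 \<Longrightarrow> \<alpha> k = 1 / (2 * Lc k)"
    and delta: "0 \<le> \<delta>" "\<delta> < 1"
    and weights: "\<And>i j. j \<ge> 1 \<Longrightarrow>
          \<omega> (update_iter b i j)
            \<le> \<delta> / 6 * sqrt (lip_value b L0 Lc i (j - 1) / lip_value b L0 Lc i j)"
begin

definition step :: "nat \<Rightarrow> real ^ 'n" where
  "step k = x k - x (k - 1)"

definition prev_update :: "nat \<Rightarrow> nat" where
  "prev_update k = last_update b (b k) (k - 1)"

text \<open>The full-space version of the extrapolated point: it agrees with \<open>x (k - 1)\<close> off the
  updated block, so both arguments of the prox-linear model are read off it.\<close>

definition z :: "nat \<Rightarrow> real ^ 'n" where
  "z k = x (k - 1) + \<omega> k *\<^sub>R step (prev_update k)"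

text \<open>Faithful only where the value is finite, which \<open>r_eq_rval\<close> secures from
  iteration \<open>T\<close> on.\<close>

definition rval :: "'s \<Rightarrow> nat \<Rightarrow> real" where
  "rval i k = real_of_ereal (r i (block blk i (x k)))"

text \<open>Minus the gradient, at the new block value, of the smooth part of the subproblem, with
  \<open>1 / (2 * \<alpha> k) = Lc k\<close>.\<close>

definition subgrad :: "nat \<Rightarrow> real ^ 'n" where
  "subgrad k = - block blk (b k) (gradf (z k) + (2 * Lc k) *\<^sub>R (x k - z k))"

lemma omega: "1 \<le> k \<Longrightarrow> 0 \<le> \<omega> k" "1 \<le> k \<Longrightarrow> \<omega> k \<le> 1"
  and block_unchanged: "1 \<le> k \<Longrightarrow> i \<noteq> b k \<Longrightarrow> block blk i (x k) = block blk i (x (k - 1))"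
  and minimizer: "1 \<le> k \<Longrightarrow> u \<in> block_space blk (b k) \<Longrightarrow>
    bpl_subproblem blk gradf r (\<alpha> k) (b k) (x (k - 1)) (extrapolated blk b \<omega> x k)
      (block blk (b k) (x k))
    \<le> bpl_subproblem blk gradf r (\<alpha> k) (b k) (x (k - 1)) (extrapolated blk b \<omega> x k) u"
  using bpl unfolding bpl_sequence_def is_arg_min_linorder by blast+

lemma Lc_pos: "1 \<le> k \<Longrightarrow> 0 < Lc k"
  using Lc_bounds[of k] l_pos by simp

section \<open>Previous updates and the extrapolated point\<close>

lemma block_x_last_update: "block blk i (x (last_update b i k)) = block blk i (x k)"
proof (induction k)
  case 0
  then show ?case
    using last_update_le[of b i 0] by simp
next
  case (Suc k)
  show ?case
  proof (cases "b (Suc k) = i")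
    case True
    then show ?thesis
      using last_update_self[of "Suc k" b] by simp
  next
    case False
    then show ?thesis
      using Suc last_update_unchanged[of "Suc k" b i] block_unchanged[of "Suc k" i] by simp
  qed
qed

lemma block_value_num_updates: "block_value blk b x i (num_updates b i k) = block blk i (x k)"
  using block_x_last_update by (simp add: block_value_def flip: last_update_def)

lemma last_update_bounds:
  assumes "T \<le> k"
  shows "1 \<le> last_update b i k" "k \<le> last_update b i k + T"
proof -
  \<comment> \<open>The window consists of the \<open>T\<close> iterations ending at
    \<open>k\<close>; \<open>T \<le> k\<close> makes the subtraction exact.\<close>
  obtain m where m: "m \<in> {k - T + 1..k - T + T}" "b m = i"
    using essentially_cyclic by blast
  then have "m \<le> last_update b i k"
    using assms by (intro last_update_ge) auto
  with m assms show "1 \<le> last_update b i k" "k \<le> last_update b i k + T"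
    by auto
qed

text \<open>\<open>T < k\<close> guarantees an earlier update of the same block, so the truncated
  subtractions of 1 and 2 from the count are exact.\<close>

lemma prev_update:
  assumes "T < k"
  shows "1 \<le> prev_update k" "b (prev_update k) = b k"
    "num_updates b (b k) (k - 1) = num_updates b (b k) k - 1"
    "num_updates b (b k) (prev_update k - 1) = num_updates b (b k) k - 2"
    "2 \<le> num_updates b (b k) k"
proof -
  show p: "1 \<le> prev_update k"
    using last_update_bounds(1)[of "k - 1" "b k"] assms by (simp add: prev_update_def)
  then show bp: "b (prev_update k) = b k"
    unfolding prev_update_def by (rule block_last_update)
  show n1: "num_updates b (b k) (k - 1) = num_updates b (b k) k - 1"
    using assms by (cases k) (simp_all add: num_updates_Suc)
  have n: "num_updates b (b k) (prev_update k) = num_updates b (b k) k - 1"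
    using n1 by (simp add: prev_update_def num_updates_last_update)
  show "num_updates b (b k) (prev_update k - 1) = num_updates b (b k) k - 2"
    using num_updates_Suc[of b "b k" "prev_update k - 1"] p bp n by simp
  show "2 \<le> num_updates b (b k) k"
    using num_updates_Suc[of b "b k" "prev_update k - 1"] p bp n by simp
qed

lemma step_in_block_space: "1 \<le> k \<Longrightarrow> step k \<in> block_space blk (b k)"
  unfolding step_def block_space_def
proof (intro CollectI allI impI)
  fix j
  assume "1 \<le> k" "blk j \<noteq> b k"
  then have "block blk (blk j) (x k) $ j = block blk (blk j) (x (k - 1)) $ j"
    by (simp add: block_unchanged)
  then show "(x k - x (k - 1)) $ j = 0"
    by (simp add: block_def)
qed

lemma step_prev_in_block_space: "T < k \<Longrightarrow> step (prev_update k) \<in> block_space blk (b k)"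
  using step_in_block_space[of "prev_update k"] prev_update[of k] by simp

text \<open>The last two values of the block are those right after and right before its previous
  update, so they differ by the block of \<open>step (prev_update k)\<close>.\<close>

lemma extrapolated_eq:
  assumes "T < k"
  shows "extrapolated blk b \<omega> x k = block blk (b k) (z k)"
proof -
  have "block_value blk b x (b k) (num_updates b (b k) k - 1) = block blk (b k) (x (k - 1))"
    using block_value_num_updates[of "b k" "k - 1"] prev_update[OF assms] by simp
  also have "\<dots> = block blk (b k) (x (prev_update k))"
    by (simp add: prev_update_def block_x_last_update)
  finally have 1: "block_value blk b x (b k) (num_updates b (b k) k - 1)
      = block blk (b k) (x (prev_update k))" .
  have 2: "block_value blk b x (b k) (num_updates b (b k) k - 2)
      = block blk (b k) (x (prev_update k - 1))"
    using block_value_num_updates[of "b k" "prev_update k - 1"] prev_update[OF assms] by simp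
  show ?thesis
    unfolding extrapolated_def Let_def 1 2
    by (simp add: z_def step_def block_add block_scaleR block_diff prev_update_def
        block_x_last_update)
qed

lemma replace_block_extrapolated:
  assumes "T < k"
  shows "replace_block blk (b k) (x (k - 1)) (extrapolated blk b \<omega> x k) = z k"
  unfolding extrapolated_eq[OF assms] replace_block_eq z_def
  by (simp add: block_eq_self block_add block_scaleR step_prev_in_block_space[OF assms])

section \<open>Finiteness and optimality of the updated blocks\<close>

lemma r_not_MInf: "u \<in> block_space blk i \<Longrightarrow> r i u \<noteq> -\<infinity>"
  using r_proper[of i] by (simp add: proper_on_def)

text \<open>Properness gives a point where the subproblem is below infinity, whatever the previous
  iterate is, and the minimizer does no worse.\<close>

lemma r_updated_finite:
  assumes "1 \<le> k"
  shows "r (b k) (block blk (b k) (x k)) < \<infinity>"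
proof -
  obtain u where u: "u \<in> block_space blk (b k)" "r (b k) u < \<infinity>"
    using r_proper[of "b k"] by (auto simp: proper_on_def)
  have "bpl_subproblem blk gradf r (\<alpha> k) (b k) (x (k - 1)) (extrapolated blk b \<omega> x k) u < \<infinity>"
    using u by (simp add: bpl_subproblem_def)
  with minimizer[OF assms u(1)] show ?thesis
    by (auto simp: bpl_subproblem_def)
qed

lemma r_eq_rval:
  assumes "T \<le> k"
  shows "r i (block blk i (x k)) = ereal (rval i k)"
proof -
  have "r i (block blk i (x k)) < \<infinity>"
    using r_updated_finite[of "last_update b i k"] last_update_bounds(1)[OF assms, of i]
      block_last_update[of b i k] by (simp add: block_x_last_update)
  then show ?thesis
    using r_not_MInf[of "block blk i (x k)" i]
    by (cases "r i (block blk i (x k))") (simp_all add: rval_def)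
qed

text \<open>Completing the square in the optimality condition of the prox-linear model. The descent
  estimate, the Frechet subgradients and the upper semicontinuity along the iterates all
  come from this inequality.\<close>

lemma prox_inequality:
  assumes k: "T < k" and u: "u \<in> block_space blk (b k)"
  shows "ereal (rval (b k) k + subgrad k \<bullet> (u - block blk (b k) (x k))
      - Lc k * (norm (u - block blk (b k) (x k)))\<^sup>2) \<le> r (b k) u"
proof (cases "r (b k) u")
  case (real w)
  define a where "a = u - block blk (b k) (x k)"
  define c where "c = block blk (b k) (x k) - block blk (b k) (z k)"
  define d where "d = block blk (b k) (gradf (z k))"
  have ac: "u - block blk (b k) (z k) = a + c"
    by (simp add: a_def c_def)
  have "1 / (2 * \<alpha> k) = Lc k"
    using stepsize[of k] k Lc_pos[of k] by simp
  then have "ereal (d \<bullet> c + Lc k * (norm c)\<^sup>2) + ereal (rval (b k) k)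
      \<le> ereal (d \<bullet> (a + c) + Lc k * (norm (a + c))\<^sup>2) + ereal w"
    using minimizer[of k u] u k r_eq_rval[of k "b k"] real
    unfolding bpl_subproblem_def replace_block_extrapolated[OF k]
    by (simp add: extrapolated_eq[OF k] d_def c_def ac)
  then have "rval (b k) k - d \<bullet> a - 2 * Lc k * (c \<bullet> a) - Lc k * (norm a)\<^sup>2 \<le> w"
    by (simp add: power2_norm_eq_inner algebra_simps inner_commute)
  moreover have "subgrad k = - d - (2 * Lc k) *\<^sub>R c"
    by (simp add: subgrad_def d_def c_def block_add block_scaleR block_diff)
  ultimately show ?thesis
    using real by (simp add: a_def[symmetric] inner_diff_left)
qed (use r_not_MInf[OF u] in auto)

text \<open>Applied with \<open>v\<close> a fraction of the step, for the descent of
  \<open>f\<close>, and with \<open>v\<close> the extrapolation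
  \<open>z k - x (k - 1)\<close>.\<close>

lemma gradient_lipschitz:
  assumes "1 \<le> k" "v \<in> block_space blk (b k)"
  shows "norm (block blk (b k) (gradf (x (k - 1) + v) - gradf (x (k - 1)))) \<le> Lc k * norm v"
proof -
  let ?y = "block blk (b k) (x (k - 1))"
  have v: "?y + v \<in> block_space blk (b k)"
    using assms(2) by (auto simp: block_space_def block_def)
  have "dist (block blk (b k) (gradf (replace_block blk (b k) (x (k - 1)) (?y + v))))
      (block blk (b k) (gradf (replace_block blk (b k) (x (k - 1)) ?y))) \<le> Lc k * dist (?y + v) ?y"
    by (rule lipschitz_onD[OF lipschitz[OF assms(1)] v block_in_block_space])
  then show ?thesis
    using assms(2)
    by (simp add: replace_block_eq block_add block_eq_self dist_norm block_diff)
qed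

section \<open>Decrease of the objective and of the Lyapunov function\<close>

definition objective :: "nat \<Rightarrow> real" where
  "objective k = f (x k) + (\<Sum>i\<in>UNIV. rval i k)"

lemma F_eq_objective: "T \<le> k \<Longrightarrow> F (x k) = ereal (objective k)"
  by (simp add: F_eq objective_def r_eq_rval)

text \<open>The factor \<open>- 1 / 2\<close> is \<open>1 / 2\<close> from the descent of
  \<open>f\<close> minus \<open>1\<close> from \<open>prox_inequality\<close> at the old block. The
  factor \<open>3\<close> is \<open>1\<close> for replacing the gradient at \<open>z k\<close> by
  that at \<open>x (k - 1)\<close>, plus \<open>2\<close> from the cross term of the proximal
  square.\<close>

lemma objective_decrease:
  assumes k: "T < k"
  shows "objective k \<le> objective (k - 1) - Lc k / 2 * (norm (step k))\<^sup>2
    + 3 * Lc k * \<omega> k * norm (step (prev_update k)) * norm (step k)"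
proof -
  define s where "s = step k"
  define p where "p = step (prev_update k)"
  have k1: "1 \<le> k"
    using k by simp
  have s: "s \<in> block_space blk (b k)" and p: "p \<in> block_space blk (b k)"
    using step_in_block_space[OF k1] step_prev_in_block_space[OF k] by (simp_all add: s_def p_def)
  have xk: "x k = x (k - 1) + s"
    by (simp add: s_def step_def)
  have f: "f (x (k - 1) + s) \<le> f (x (k - 1)) + gradf (x (k - 1)) \<bullet> s + Lc k / 2 * (norm s)\<^sup>2"
  proof (rule descent_on_segment[OF f_grad])
    fix t :: real
    assume t: "0 \<le> t"
    have ts: "t *\<^sub>R s \<in> block_space blk (b k)"
      using s by (simp add: block_space_def)
    have "(gradf (x (k - 1) + t *\<^sub>R s) - gradf (x (k - 1))) \<bullet> s
        \<le> norm (block blk (b k) (gradf (x (k - 1) + t *\<^sub>R s) - gradf (x (k - 1)))) * norm s"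
      by (rule inner_le_norm_block[OF s])
    also have "\<dots> \<le> Lc k * norm (t *\<^sub>R s) * norm s"
      by (intro mult_right_mono gradient_lipschitz k1 ts) simp
    finally show "(gradf (x (k - 1) + t *\<^sub>R s) - gradf (x (k - 1))) \<bullet> s \<le> Lc k * t * (norm s)\<^sup>2"
      using t by (simp add: power2_eq_square algebra_simps)
  qed
  have "(gradf (x (k - 1)) - gradf (z k)) \<bullet> s
      \<le> norm (block blk (b k) (gradf (x (k - 1)) - gradf (z k))) * norm s"
    by (rule inner_le_norm_block[OF s])
  also have "\<dots> = norm (block blk (b k) (gradf (x (k - 1) + \<omega> k *\<^sub>R p) - gradf (x (k - 1)))) * norm s"
    by (simp add: z_def p_def block_diff norm_minus_commute)
  also have "\<dots> \<le> Lc k * norm (\<omega> k *\<^sub>R p) * norm s"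
    using p by (intro mult_right_mono gradient_lipschitz k1) (simp_all add: block_space_def)
  finally have g: "(gradf (x (k - 1)) - gradf (z k)) \<bullet> s \<le> Lc k * \<omega> k * norm p * norm s"
    using omega[OF k1] by (simp add: mult.assoc)
  have "block blk (b k) (x (k - 1)) - block blk (b k) (x k) = - s"
    using s by (simp add: xk block_add block_eq_self)
  then have "rval (b k) k + subgrad k \<bullet> (- s) - Lc k * (norm (- s))\<^sup>2 \<le> rval (b k) (k - 1)"
    using prox_inequality[OF k block_in_block_space, of "x (k - 1)"] r_eq_rval[of "k - 1" "b k"] k
    by simp
  moreover have "subgrad k \<bullet> (- s) = gradf (z k) \<bullet> s + 2 * Lc k * (norm s)\<^sup>2
      - 2 * Lc k * \<omega> k * (p \<bullet> s)"
    using s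
    by (simp add: subgrad_def block_inner inner_add_left xk z_def p_def[symmetric]
        power2_norm_eq_inner algebra_simps)
  moreover have "Lc k * \<omega> k * (p \<bullet> s) \<le> Lc k * \<omega> k * (norm p * norm s)"
    using Lc_pos[OF k1] omega[OF k1] by (intro mult_left_mono norm_cauchy_schwarz) simp
  ultimately have rb: "rval (b k) k \<le> rval (b k) (k - 1) - gradf (z k) \<bullet> s - Lc k * (norm s)\<^sup>2
      + 2 * (Lc k * \<omega> k * norm p * norm s)"
    by (simp add: algebra_simps)
  have "rval i k = rval i (k - 1)" if "i \<noteq> b k" for i
    using block_unchanged[OF k1 that] by (simp add: rval_def)
  then have "(\<Sum>i\<in>UNIV - {b k}. rval i k) = (\<Sum>i\<in>UNIV - {b k}. rval i (k - 1))"
    by (intro sum.cong) auto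
  then have "(\<Sum>i\<in>UNIV. rval i k) - rval (b k) k = (\<Sum>i\<in>UNIV. rval i (k - 1)) - rval (b k) (k - 1)"
    by (simp add: sum.remove[of UNIV "b k"])
  with f[folded xk] g rb have "objective k \<le> objective (k - 1) - Lc k / 2 * (norm s)\<^sup>2
      + 3 * (Lc k * \<omega> k * norm p * norm s)"
    by (simp add: objective_def inner_diff_left)
  then show ?thesis
    by (simp add: s_def p_def mult.assoc)
qed

text \<open>For \<open>T < k\<close> the index \<open>j - 1\<close> in the weight bound is at least
  1, so \<open>lip_value\<close> is the constant of the previous update and not the arbitrary
  \<open>L0\<close>.\<close>

lemma omega_le:
  assumes "T < k"
  shows "\<omega> k \<le> \<delta> / 6 * sqrt (Lc (prev_update k) / Lc k)"
proof -
  have "update_iter b (b k) (num_updates b (b k) k) = k"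
    using last_update_self[of k b] assms by (simp add: last_update_def)
  moreover have "update_iter b (b k) (num_updates b (b k) k - 1) = prev_update k"
    using prev_update(3)[OF assms] by (simp add: prev_update_def last_update_def)
  ultimately show ?thesis
    using weights[of "num_updates b (b k) k" "b k"] prev_update(5)[OF assms]
    by (simp add: lip_value_def)
qed

lemma momentum_bound:
  assumes k: "T < k"
  shows "3 * Lc k * \<omega> k * norm (step (prev_update k)) * norm (step k)
    \<le> \<delta> / 4 * (Lc k * (norm (step k))\<^sup>2 + Lc (prev_update k) * (norm (step (prev_update k)))\<^sup>2)"
proof -
  define A where "A = Lc k"
  define B where "B = Lc (prev_update k)"
  define s where "s = norm (step k)"
  define p where "p = norm (step (prev_update k))"
  have pos: "0 < A" "0 < B" "0 \<le> s" "0 \<le> p"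
    using k Lc_pos[of k] Lc_pos[of "prev_update k"] prev_update(1)[OF k]
    by (simp_all add: A_def B_def s_def p_def)
  have "A * \<omega> k \<le> A * (\<delta> / 6 * sqrt (B / A))"
    using omega_le[OF k] pos by (intro mult_left_mono) (simp_all add: A_def B_def)
  also have "A * (\<delta> / 6 * sqrt (B / A)) = \<delta> / 6 * (sqrt A * sqrt B)"
    using pos real_sqrt_mult_self[of A] by (simp add: real_sqrt_divide field_simps)
  finally have "3 * (A * \<omega> k) * (p * s) \<le> 3 * (\<delta> / 6 * (sqrt A * sqrt B)) * (p * s)"
    using pos by (intro mult_right_mono) simp_all
  \<comment> \<open>The factor is split off so that \<open>2 * a * b \<le> a^2 + b^2\<close> applies
    with \<open>a = sqrt A * s\<close> and \<open>b = sqrt B * p\<close>.\<close>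
  also have "\<dots> = \<delta> / 4 * (2 * (sqrt A * s) * (sqrt B * p))"
    by simp
  also have "\<dots> \<le> \<delta> / 4 * ((sqrt A * s)\<^sup>2 + (sqrt B * p)\<^sup>2)"
    using delta sum_squares_bound[of "sqrt A * s" "sqrt B * p"] by (intro mult_left_mono) simp_all
  also have "\<dots> = \<delta> / 4 * (A * s\<^sup>2 + B * p\<^sup>2)"
    using pos by (simp add: power_mult_distrib)
  finally show ?thesis
    by (simp add: A_def B_def s_def p_def mult.assoc)
qed

text \<open>The second term stores, for each block, the share of its latest step that the
  extrapolation at its next update may give back.\<close>

definition lyapunov :: "nat \<Rightarrow> real" where
  "lyapunov k = objective k
    + \<delta> / 4 * (\<Sum>i\<in>UNIV. Lc (last_update b i k) * (norm (step (last_update b i k)))\<^sup>2)"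

text \<open>Only the stored term of block \<open>b k\<close> changes. Its old value absorbs the
  previous step in \<open>momentum_bound\<close>; of the coefficient \<open>1 / 2\<close> of the new
  step, \<open>\<delta> / 4\<close> pays for the momentum and \<open>\<delta> / 4\<close> for the
  new stored term.\<close>

lemma lyapunov_decrease:
  assumes k: "T < k"
  shows "lyapunov k \<le> lyapunov (k - 1) - (1 - \<delta>) / 2 * l * (norm (step k))\<^sup>2"
proof -
  define h where "h m i = Lc (last_update b i m) * (norm (step (last_update b i m)))\<^sup>2" for m i
  have "h k i = h (k - 1) i" if "i \<noteq> b k" for i
    using last_update_unchanged[of k b i] that k by (simp add: h_def)
  then have "(\<Sum>i\<in>UNIV - {b k}. h k i) = (\<Sum>i\<in>UNIV - {b k}. h (k - 1) i)"
    by (intro sum.cong) auto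
  then have "sum (h k) UNIV - h k (b k) = sum (h (k - 1)) UNIV - h (k - 1) (b k)"
    by (simp add: sum.remove[of UNIV "b k"])
  moreover have "h k (b k) = Lc k * (norm (step k))\<^sup>2"
    using last_update_self[of k b] k by (simp add: h_def)
  moreover have "h (k - 1) (b k) = Lc (prev_update k) * (norm (step (prev_update k)))\<^sup>2"
    by (simp add: h_def prev_update_def)
  ultimately have h: "sum (h k) UNIV = sum (h (k - 1)) UNIV + Lc k * (norm (step k))\<^sup>2
      - Lc (prev_update k) * (norm (step (prev_update k)))\<^sup>2"
    by simp
  have "objective k \<le> objective (k - 1) - Lc k / 2 * (norm (step k))\<^sup>2
      + \<delta> / 4 * (Lc k * (norm (step k))\<^sup>2 + Lc (prev_update k) * (norm (step (prev_update k)))\<^sup>2)"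
    using objective_decrease[OF k] momentum_bound[OF k] by simp
  then have "lyapunov k \<le> lyapunov (k - 1) - (1 - \<delta>) / 2 * (Lc k * (norm (step k))\<^sup>2)"
    unfolding lyapunov_def h_def[symmetric] h by (simp add: algebra_simps diff_divide_distrib)
  moreover have "(1 - \<delta>) / 2 * (l * (norm (step k))\<^sup>2) \<le> (1 - \<delta>) / 2 * (Lc k * (norm (step k))\<^sup>2)"
    using delta Lc_bounds[of k] k by (intro mult_left_mono mult_right_mono) simp_all
  ultimately show ?thesis
    by simp
qed

lemma lyapunov_bounded_below: "\<exists>m. \<forall>k\<ge>T. m \<le> lyapunov k"
proof -
  obtain m :: real where m: "\<And>y. F y < \<infinity> \<Longrightarrow> ereal m \<le> F y"
    using F_bounded_below by blast
  have "m \<le> lyapunov k" if k: "T \<le> k" for k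
  proof -
    have "m \<le> objective k"
      using m[of "x k"] by (simp add: F_eq_objective[OF k])
    moreover have "0 \<le> Lc (last_update b i k)" for i
      using last_update_bounds(1)[OF k] Lc_pos[of "last_update b i k"] by (simp add: less_imp_le)
    then have "0 \<le> \<delta> / 4 * (\<Sum>i\<in>UNIV. Lc (last_update b i k) * (norm (step (last_update b i k)))\<^sup>2)"
      using delta by (intro mult_nonneg_nonneg sum_nonneg) simp_all
    ultimately show ?thesis
      by (simp add: lyapunov_def)
  qed
  then show ?thesis
    by blast
qed

section \<open>Vanishing steps and lags\<close>

lemma step_tendsto_0: "step \<longlonglongrightarrow> 0"
proof -
  define c where "c = (1 - \<delta>) / 2 * l"
  have c: "0 < c"
    using delta l_pos by (simp add: c_def)
  \<comment> \<open>The decrease holds only after iteration \<open>T\<close>, hence the shift. The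
    differences of a bounded nonincreasing sequence tend to 0, and here they dominate
    \<open>c\<close> times the squared steps.\<close>
  define \<psi> where "\<psi> n = lyapunov (n + T)" for n
  have dec: "\<psi> (Suc n) \<le> \<psi> n - c * (norm (step (Suc n + T)))\<^sup>2" for n
    using lyapunov_decrease[of "Suc n + T"] by (simp add: \<psi>_def c_def)
  have "\<psi> (Suc n) \<le> \<psi> n" for n
    using dec[of n] c by (smt (verit) mult_nonneg_nonneg zero_le_power2)
  then have "decseq \<psi>"
    by (rule decseq_SucI)
  moreover obtain m where "\<forall>k\<ge>T. m \<le> lyapunov k"
    using lyapunov_bounded_below by blast
  then have "\<forall>n. m \<le> \<psi> n"
    by (simp add: \<psi>_def)
  ultimately obtain a where a: "\<psi> \<longlonglongrightarrow> a"
    by (rule decseq_convergent)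
  then have "(\<lambda>n. (\<psi> n - \<psi> (Suc n)) / c) \<longlonglongrightarrow> (a - a) / c"
    using LIMSEQ_Suc[OF a] c by (intro tendsto_intros) simp_all
  then have "(\<lambda>n. (\<psi> n - \<psi> (Suc n)) / c) \<longlonglongrightarrow> 0"
    by simp
  then have "(\<lambda>n. (norm (step (Suc n + T)))\<^sup>2) \<longlonglongrightarrow> 0"
    by (rule tendsto_sandwich[OF _ _ tendsto_const, rotated 2])
      (use dec c in \<open>auto simp: field_simps\<close>)
  then have "(\<lambda>n. sqrt ((norm (step (Suc n + T)))\<^sup>2)) \<longlonglongrightarrow> sqrt 0"
    by (rule tendsto_real_sqrt)
  then have "(\<lambda>n. norm (step (n + Suc T))) \<longlonglongrightarrow> 0"
    by simp
  then show ?thesis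
    using LIMSEQ_offset tendsto_norm_zero_iff by blast
qed

text \<open>A fixed delay \<open>d\<close> is a sum of \<open>d\<close> steps. As the actual delay
  varies with \<open>k\<close>, the sum over all delays up to \<open>T\<close> serves as
  majorant.\<close>

lemma lag_tendsto_0:
  assumes q: "eventually (\<lambda>k. q k \<le> k \<and> k \<le> q k + T) sequentially"
  shows "(\<lambda>k. x (q k) - x k) \<longlonglongrightarrow> 0"
proof -
  have d: "(\<lambda>k. norm (x k - x (k - d))) \<longlonglongrightarrow> 0" for d
  proof (induction d)
    case (Suc d)
    have "(\<lambda>k. step (k - d)) \<longlonglongrightarrow> 0"
      by (rule filterlim_compose[OF step_tendsto_0 filterlim_minus_const_nat_at_top])
    then have "(\<lambda>k. norm (x k - x (k - d)) + norm (step (k - d))) \<longlonglongrightarrow> 0"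
      using tendsto_add[OF Suc tendsto_norm_zero] by simp
    then show ?case
      by (rule tendsto_sandwich[OF _ _ tendsto_const, rotated 2])
        (auto simp: step_def intro!: always_eventually norm_diff_triangle_le)
  qed simp
  have "(\<lambda>k. \<Sum>d\<le>T. norm (x k - x (k - d))) \<longlonglongrightarrow> (\<Sum>d\<le>T. 0)"
    by (intro tendsto_sum d)
  then have "(\<lambda>k. \<Sum>d\<le>T. norm (x k - x (k - d))) \<longlonglongrightarrow> 0"
    by simp
  then show ?thesis
  proof (rule Lim_null_comparison[rotated])
    show "eventually (\<lambda>k. norm (x (q k) - x k) \<le> (\<Sum>d\<le>T. norm (x k - x (k - d)))) sequentially"
      using q
    proof eventually_elim
      case (elim k)
      then have "norm (x (q k) - x k) = norm (x k - x (k - (k - q k)))"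
        by (simp add: norm_minus_commute)
      also have "\<dots> \<le> (\<Sum>d\<le>T. norm (x k - x (k - d)))"
        using elim by (intro member_le_sum) auto
      finally show ?case .
    qed
  qed
qed

lemma filterlim_last_update: "filterlim (last_update b i) at_top sequentially"
proof (rule filterlim_at_top_mono[OF filterlim_minus_const_nat_at_top[of T]])
  show "eventually (\<lambda>k. k - T \<le> last_update b i k) sequentially"
    using eventually_ge_at_top[of T] by eventually_elim (metis last_update_bounds(2) le_diff_conv)
qed

lemma last_update_lag: "(\<lambda>k. x (last_update b i k) - x k) \<longlonglongrightarrow> 0"
  by (rule lag_tendsto_0, rule eventually_mono[OF eventually_ge_at_top[of T]])
    (simp add: last_update_le last_update_bounds)

lemma z_minus_x_tendsto_0: "(\<lambda>k. z k - x k) \<longlonglongrightarrow> 0"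
proof (rule Lim_null_comparison)
  \<comment> \<open>The block \<open>b k\<close> varies with \<open>k\<close>; summing over all
    blocks gives a majorant whose limit can be taken termwise.\<close>
  have p: "norm (step (prev_update k)) \<le> (\<Sum>i\<in>UNIV. norm (step (last_update b i (k - 1))))" for k
    unfolding prev_update_def by (intro member_le_sum) auto
  show "eventually (\<lambda>k. norm (z k - x k)
      \<le> norm (step k) + (\<Sum>i\<in>UNIV. norm (step (last_update b i (k - 1))))) sequentially"
    using eventually_ge_at_top[of 1]
  proof eventually_elim
    case (elim k)
    have "norm (z k - x k) = norm (\<omega> k *\<^sub>R step (prev_update k) - step k)"
      by (simp add: z_def step_def algebra_simps)
    also have "\<dots> \<le> norm (\<omega> k *\<^sub>R step (prev_update k)) + norm (step k)"
      by (rule norm_triangle_ineq4)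
    also have "norm (\<omega> k *\<^sub>R step (prev_update k)) \<le> norm (step (prev_update k))"
      using omega[OF elim] by (simp add: mult_left_le_one_le)
    finally show ?case
      using p[of k] by simp
  qed
  have "(\<lambda>k. step (last_update b i (k - 1))) \<longlonglongrightarrow> 0" for i
    by (intro filterlim_compose[OF step_tendsto_0] filterlim_compose[OF filterlim_last_update]
        filterlim_minus_const_nat_at_top)
  then have "(\<lambda>k. norm (step k) + (\<Sum>i\<in>UNIV. norm (step (last_update b i (k - 1)))))
      \<longlonglongrightarrow> norm (0 :: real ^ 'n) + (\<Sum>i\<in>(UNIV :: 's set). norm (0 :: real ^ 'n))"
    by (intro tendsto_intros step_tendsto_0)
  then show "(\<lambda>k. norm (step k) + (\<Sum>i\<in>UNIV. norm (step (last_update b i (k - 1))))) \<longlonglongrightarrow> 0"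
    by simp
qed

section \<open>Limits of subgradients and criticality\<close>

lemma subgrad_tendsto:
  assumes \<phi>: "filterlim \<phi> at_top sequentially" and lim: "(\<lambda>m. x (\<phi> m)) \<longlonglongrightarrow> xbar"
  shows "(\<lambda>m. subgrad (last_update b i (\<phi> m))) \<longlonglongrightarrow> - block blk i (gradf xbar)"
proof -
  define q where "q m = last_update b i (\<phi> m)" for m
  have q: "filterlim q at_top sequentially"
    unfolding q_def by (rule filterlim_compose[OF filterlim_last_update \<phi>])
  have zx: "(\<lambda>m. z (q m) - x (q m)) \<longlonglongrightarrow> 0"
    by (rule filterlim_compose[OF z_minus_x_tendsto_0 q])
  have xx: "(\<lambda>m. x (q m) - x (\<phi> m)) \<longlonglongrightarrow> 0"
    unfolding q_def by (rule filterlim_compose[OF last_update_lag \<phi>])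
  have "(\<lambda>m. z (q m) - x (q m) + (x (q m) - x (\<phi> m)) + x (\<phi> m)) \<longlonglongrightarrow> 0 + 0 + xbar"
    by (intro tendsto_add zx xx lim)
  then have "(\<lambda>m. z (q m)) \<longlonglongrightarrow> xbar"
    by simp
  then have gz: "(\<lambda>m. gradf (z (q m))) \<longlonglongrightarrow> gradf xbar"
    by (intro continuous_on_tendsto_compose[OF f_C1]) simp_all
  have ev: "eventually (\<lambda>m. 1 \<le> q m) sequentially"
    using q by (simp add: filterlim_at_top)
  \<comment> \<open>The constants \<open>Lc\<close> need not converge; their upper bound
    \<open>L\<close> suffices because the distance from \<open>z\<close> to \<open>x\<close>
    vanishes.\<close>
  have "(\<lambda>m. (2 * Lc (q m)) *\<^sub>R (x (q m) - z (q m))) \<longlonglongrightarrow> 0"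
  proof (rule Lim_null_comparison)
    show "eventually (\<lambda>m. norm ((2 * Lc (q m)) *\<^sub>R (x (q m) - z (q m)))
        \<le> 2 * L * norm (z (q m) - x (q m))) sequentially"
      using ev
    proof eventually_elim
      case (elim m)
      then show ?case
        using Lc_bounds[of "q m"] Lc_pos[of "q m"]
        by (simp add: norm_minus_commute mult_right_mono)
    qed
    show "(\<lambda>m. 2 * L * norm (z (q m) - x (q m))) \<longlonglongrightarrow> 0"
      using tendsto_mult_right_zero[OF tendsto_norm_zero[OF zx]] by simp
  qed
  with gz have "(\<lambda>m. - block blk i (gradf (z (q m)) + (2 * Lc (q m)) *\<^sub>R (x (q m) - z (q m))))
      \<longlonglongrightarrow> - block blk i (gradf xbar + 0)"
    by (intro tendsto_intros)
  moreover have "eventually (\<lambda>m. - block blk i (gradf (z (q m)) + (2 * Lc (q m)) *\<^sub>R (x (q m) - z (q m)))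
      = subgrad (q m)) sequentially"
    using ev by eventually_elim (simp add: subgrad_def q_def block_last_update)
  ultimately show ?thesis
    unfolding q_def by (simp add: tendsto_cong)
qed

text \<open>The bound \<open>T + T\<close> makes the latest update of every block an iteration after \<open>T\<close>,
  where \<open>prox_inequality\<close> applies.\<close>

lemma prox_inequality_last_update:
  assumes k: "T + T < k" and u: "u \<in> block_space blk i"
  shows "ereal (rval i k + subgrad (last_update b i k) \<bullet> (u - block blk i (x k))
      - L * (norm (u - block blk i (x k)))\<^sup>2) \<le> r i u"
proof -
  define q where "q = last_update b i k"
  have q: "T < q" "b q = i"
    using k last_update_bounds[of k i] block_last_update[of b i k] by (auto simp: q_def)
  have xq: "block blk i (x q) = block blk i (x k)"
    by (simp add: q_def block_x_last_update)
  then have "rval i q = rval i k"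
    by (simp add: rval_def)
  moreover have "Lc q * (norm (u - block blk i (x k)))\<^sup>2 \<le> L * (norm (u - block blk i (x k)))\<^sup>2"
    using Lc_bounds[of q] q by (intro mult_right_mono) simp_all
  ultimately have "ereal (rval i k + subgrad q \<bullet> (u - block blk i (x k))
      - L * (norm (u - block blk i (x k)))\<^sup>2)
    \<le> ereal (rval i q + subgrad q \<bullet> (u - block blk i (x q)) - Lc q * (norm (u - block blk i (x q)))\<^sup>2)"
    by (simp add: xq)
  also have "\<dots> \<le> r i u"
    using prox_inequality[OF q(1), of u] u q by simp
  finally show ?thesis
    by (simp add: q_def)
qed

text \<open>The latest update of each block yields a quadratic minorant of its term, touching it at
  \<open>x k\<close> because the block has not moved since. The minorants add up to one with
  curvature constant \<open>CARD('s) * L\<close>.\<close>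

lemma subgrad_frechet:
  assumes k: "T + T < k"
  shows "gradf (x k) + (\<Sum>i\<in>UNIV. subgrad (last_update b i k)) \<in> frechet_subdiff F (x k)"
  unfolding F_eq
proof (rule frechet_subdiff_sum[OF f_grad])
  show "(\<Sum>i\<in>UNIV. r i (block blk i (x k))) = ereal (\<Sum>i\<in>UNIV. rval i k)"
    using k by (simp add: r_eq_rval)
  fix y
  define g where "g i = subgrad (last_update b i k)" for i
  \<comment> \<open>Each \<open>g i\<close> is supported on block \<open>i\<close>, so the block
    differences may be replaced by the full one.\<close>
  have gi: "g i \<bullet> (block blk i y - block blk i (x k)) = g i \<bullet> (y - x k)" for i
  proof -
    have "b (last_update b i k) = i"
      using k last_update_bounds(1)[of k i] by (intro block_last_update) simp
    then show ?thesis
      by (simp add: g_def subgrad_def block_inner_block flip: block_diff)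
  qed
  have "0 < L"
    using Lc_bounds[of 1] l_pos by simp
  then have "L * (norm (block blk i y - block blk i (x k)))\<^sup>2 \<le> L * (norm (y - x k))\<^sup>2" for i
    using norm_block_le[of blk i "y - x k"] by (simp add: power_mono block_diff)
  then have "ereal (rval i k + g i \<bullet> (y - x k) - L * (norm (y - x k))\<^sup>2) \<le> r i (block blk i y)" for i
    using prox_inequality_last_update[OF k block_in_block_space, of i y]
    by (elim order_trans[rotated]) (simp add: gi flip: g_def)
  then have "(\<Sum>i\<in>UNIV. ereal (rval i k + g i \<bullet> (y - x k) - L * (norm (y - x k))\<^sup>2))
      \<le> (\<Sum>i\<in>UNIV. r i (block blk i y))"
    by (rule sum_mono)
  then show "ereal ((\<Sum>i\<in>UNIV. rval i k) + (\<Sum>i\<in>UNIV. subgrad (last_update b i k)) \<bullet> (y - x k)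
      - (real CARD('s) * L) * (norm (y - x k))\<^sup>2) \<le> (\<Sum>i\<in>UNIV. r i (block blk i y))"
    by (simp add: sum.distrib sum_subtractf inner_sum_left mult.assoc flip: g_def)
qed

lemma limit_point_critical:
  assumes \<phi>: "filterlim \<phi> at_top sequentially" and lim: "(\<lambda>m. x (\<phi> m)) \<longlonglongrightarrow> xbar"
  shows "0 \<in> limiting_subdiff F xbar"
proof -
  define v where "v k = gradf (x k) + (\<Sum>i\<in>UNIV. subgrad (last_update b i k))" for k
  have "(\<lambda>m. gradf (x (\<phi> m))) \<longlonglongrightarrow> gradf xbar"
    by (intro continuous_on_tendsto_compose[OF f_C1 lim]) simp_all
  then have "(\<lambda>m. v (\<phi> m)) \<longlonglongrightarrow> gradf xbar + (\<Sum>i\<in>UNIV. - block blk i (gradf xbar))"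
    unfolding v_def by (intro tendsto_intros subgrad_tendsto[OF \<phi> lim])
  \<comment> \<open>The blocks of \<open>gradf xbar\<close> sum to \<open>gradf xbar\<close>, so
    everything cancels.\<close>
  then have v0: "(\<lambda>m. v (\<phi> m)) \<longlonglongrightarrow> 0"
    by (simp add: sum_negf sum_block)
  have "eventually (\<lambda>m. T + T < \<phi> m) sequentially"
    using \<phi> by (auto simp: filterlim_at_top Suc_le_eq dest: spec[of _ "Suc (T + T)"])
  then obtain N where N: "\<And>m. N \<le> m \<Longrightarrow> T + T < \<phi> m"
    by (auto simp: eventually_sequentially)
  \<comment> \<open>The limiting subdifferential asks for a subgradient at every index, so the first
    \<open>N\<close> terms are dropped.\<close>
  have "v (\<phi> (m + N)) \<in> frechet_subdiff F (x (\<phi> (m + N)))" for m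
    unfolding v_def by (rule subgrad_frechet) (simp add: N)
  moreover note LIMSEQ_ignore_initial_segment[OF lim, of N] LIMSEQ_ignore_initial_segment[OF v0, of N]
  ultimately show ?thesis
    unfolding limiting_subdiff_def
    by (intro CollectI exI[of _ "\<lambda>m. x (\<phi> (m + N))"] exI[of _ "\<lambda>m. v (\<phi> (m + N))"]) simp
qed

section \<open>Convergence of the function values\<close>

lemma r_tendsto:
  assumes \<phi>: "filterlim \<phi> at_top sequentially" and lim: "(\<lambda>m. x (\<phi> m)) \<longlonglongrightarrow> xbar"
  shows "(\<lambda>m. r i (block blk i (x (\<phi> m)))) \<longlonglongrightarrow> r i (block blk i xbar)"
proof (rule order_tendstoI)
  have bl: "(\<lambda>m. block blk i (x (\<phi> m))) \<longlonglongrightarrow> block blk i xbar"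
    by (intro tendsto_intros lim)
  fix a
  {
    assume "a < r i (block blk i xbar)"
    then have "eventually (\<lambda>v. v \<in> block_space blk i \<longrightarrow> a < r i v) (nhds (block blk i xbar))"
      by (intro lsc_onD_eventually[OF r_lsc]) simp_all
    with bl have "eventually (\<lambda>m. block blk i (x (\<phi> m)) \<in> block_space blk i
        \<longrightarrow> a < r i (block blk i (x (\<phi> m)))) sequentially"
      by (rule eventually_compose_filterlim[rotated])
    then show "eventually (\<lambda>m. a < r i (block blk i (x (\<phi> m)))) sequentially"
      by simp
  }
  \<comment> \<open>An upper bound strictly above the limit value forces that value to be finite;
    for an infinite one the claim is vacuous.\<close>
  assume a: "r i (block blk i xbar) < a"
  then obtain w where w: "r i (block blk i xbar) = ereal w"
    using r_not_MInf[of "block blk i xbar" i] by (cases "r i (block blk i xbar)") auto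
  \<comment> \<open>The linear and quadratic terms of the prox inequality at the block of
    \<open>xbar\<close>; they vanish because the subgradients converge.\<close>
  define e where "e m = subgrad (last_update b i (\<phi> m)) \<bullet> (block blk i xbar - block blk i (x (\<phi> m)))
      - L * (norm (block blk i xbar - block blk i (x (\<phi> m))))\<^sup>2" for m
  have "e \<longlonglongrightarrow> (- block blk i (gradf xbar)) \<bullet> (block blk i xbar - block blk i xbar)
      - L * (norm (block blk i xbar - block blk i xbar))\<^sup>2"
    unfolding e_def by (intro tendsto_intros bl subgrad_tendsto[OF \<phi> lim])
  then have "(\<lambda>m. ereal (w - e m)) \<longlonglongrightarrow> ereal (w - 0)"
    by (intro tendsto_intros) simp
  then have "eventually (\<lambda>m. ereal (w - e m) < a) sequentially"
    using a w by (intro order_tendstoD(2)) simp_all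
  moreover have "eventually (\<lambda>m. T + T < \<phi> m) sequentially"
    using \<phi> by (auto simp: filterlim_at_top Suc_le_eq dest: spec[of _ "Suc (T + T)"])
  ultimately show "eventually (\<lambda>m. r i (block blk i (x (\<phi> m))) < a) sequentially"
  proof eventually_elim
    case (elim m)
    have "rval i (\<phi> m) + e m \<le> w"
      using prox_inequality_last_update[OF elim(2) block_in_block_space, of i xbar]
      by (simp add: w e_def)
    then have "r i (block blk i (x (\<phi> m))) \<le> ereal (w - e m)"
      using r_eq_rval[of "\<phi> m" i] elim(2) by simp
    then show ?case
      using elim(1) by (rule le_less_trans)
  qed
qed

lemma F_tendsto:
  assumes \<phi>: "filterlim \<phi> at_top sequentially" and lim: "(\<lambda>m. x (\<phi> m)) \<longlonglongrightarrow> xbar"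
  shows "(\<lambda>m. F (x (\<phi> m))) \<longlonglongrightarrow> F xbar"
proof -
  have "isCont f xbar"
    using f_grad[of xbar] unfolding gderiv_def by (rule has_derivative_continuous)
  then have "(\<lambda>m. f (x (\<phi> m))) \<longlonglongrightarrow> f xbar"
    using lim by (rule isCont_tendsto_compose)
  then have f: "(\<lambda>m. ereal (f (x (\<phi> m)))) \<longlonglongrightarrow> ereal (f xbar)"
    by (rule tendsto_ereal)
  have "(\<lambda>m. \<Sum>i\<in>UNIV. r i (block blk i (x (\<phi> m)))) \<longlonglongrightarrow> (\<Sum>i\<in>UNIV. r i (block blk i xbar))"
    by (rule tendsto_sum_ereal) (simp_all add: r_tendsto[OF \<phi> lim] r_not_MInf)
  with f show ?thesis
    unfolding F_eq by (intro tendsto_add_ereal_general) simp_all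
qed

end

theorem theorem2p3:
  fixes blk :: "'n::finite \<Rightarrow> 's::finite"
    and f :: "real ^ 'n \<Rightarrow> real"
    and gradf :: "real ^ 'n \<Rightarrow> real ^ 'n"
    and r :: "'s \<Rightarrow> real ^ 'n \<Rightarrow> ereal"
    and F :: "real ^ 'n \<Rightarrow> ereal"
    and b :: "nat \<Rightarrow> 's"
    and \<alpha> \<omega> Lc :: "nat \<Rightarrow> real"
    and L0 :: "'s \<Rightarrow> real"
    and l L \<delta> :: real
    and T :: nat
    and x :: "nat \<Rightarrow> real ^ 'n"
  assumes blocks: "surj blk"
    and F_eq: "F = (\<lambda>y. ereal (f y) + (\<Sum>i\<in>UNIV. r i (block blk i y)))"
    \<comment> \<open>Assumption 1\<close>
    and f_grad: "\<And>y. GDERIV f y :> gradf y"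
    and f_C1: "continuous_on UNIV gradf"
    and r_proper: "\<And>i. proper_on (block_space blk i) (r i)"
    and r_lsc: "\<And>i. lsc_on (block_space blk i) (r i)"
    and F_proper: "proper_on UNIV F"
    and F_bounded_below: "\<exists>m::real. \<forall>y. F y < \<infinity> \<longrightarrow> ereal m \<le> F y"
    and F_critical: "\<exists>y. 0 \<in> limiting_subdiff F y"
    \<comment> \<open>the method\<close>
    and bpl: "bpl_sequence blk gradf r b \<alpha> \<omega> x"
    \<comment> \<open>Assumption 2\<close>
    and lipschitz: "\<And>k. k \<ge> 1 \<Longrightarrow>
          (Lc k)-lipschitz_on (block_space blk (b k))
            (\<lambda>u. block blk (b k) (gradf (replace_block blk (b k) (x (k - 1)) u)))"
    and l_pos: "0 < l"
    and Lc_bounds: "\<And>k. k \<ge> 1 \<Longrightarrow> l \<le> Lc k \<and> Lc k \<le> L"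
    \<comment> \<open>Assumption 3\<close>
    and essentially_cyclic: "\<And>i k. \<exists>m\<in>{k + 1..k + T}. b m = i"
    \<comment> \<open>parameters\<close>
    and stepsize: "\<And>k. k \<ge> 1 \<Longrightarrow> \<alpha> k = 1 / (2 * Lc k)"
    and L0_pos: "\<And>i. 0 < L0 i"
    and delta: "0 \<le> \<delta>" "\<delta> < 1"
    and weights: "\<And>i j. j \<ge> 1 \<Longrightarrow>
          \<omega> (update_iter b i j)
            \<le> \<delta> / 6 * sqrt (lip_value b L0 Lc i (j - 1) / lip_value b L0 Lc i j)"
  shows "(\<forall>xbar. (\<exists>\<phi>::nat \<Rightarrow> nat. strict_mono \<phi> \<and> (\<lambda>m. x (\<phi> m)) \<longlonglongrightarrow> xbar)
             \<longrightarrow> 0 \<in> limiting_subdiff F xbar)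
         \<and> (\<forall>xbar K. infinite K \<and> (\<lambda>m. x (enumerate K m)) \<longlonglongrightarrow> xbar
             \<longrightarrow> (\<lambda>m. F (x (enumerate K m))) \<longlonglongrightarrow> F xbar)"
proof -
  interpret bpl_method blk f gradf r F b \<alpha> \<omega> Lc L0 l L \<delta> T x
    by unfold_locales (fact assms)+
  show ?thesis
    using limit_point_critical[OF filterlim_subseq]
      F_tendsto[OF filterlim_subseq[OF strict_mono_enumerate]]
    by blast
qed

end
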